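(* Let $\phi:[-2,0]\to\mathbb{R}$ be a function such that the ranges of $\phi|_{[-2,-1]}$ and of $\phi|_{[-1,0]}$ both equal $[-10,10]$ and $\phi(0)=0$. Consider the problem of minimizing \[ \int_0^1 |x(t)-2t|^2+u(t)\,\mathrm{d}t+4|x(1)-2| \] over pairs $(x,u)$ with $u\in L^\infty(0,1)$, $-1\le u(t)\le 3$ for a.e. $t\in(0,1)$, and $x\in C([-2,1])\cap W^{1,\infty}(0,1)$ satisfying \[ x'(t)=\frac1{10}\max_{s\in[t-2,t]}\big(u(t)\,x(s)\big)\ \text{ for a.e. } t\in(0,1),\qquad x(t)=\phi(t)\ \text{ for } t\in[-2,0]. \] Then this problem does not possess a solution. *)

theory Defs
  imports "HOL-Analysis.Analysis"
begin

text \<open>Admissible pairs (x,u) for the delay control problem with initial datum phi.\<close>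
definition admissible :: "(real \<Rightarrow> real) \<Rightarrow> (real \<Rightarrow> real) \<Rightarrow> (real \<Rightarrow> real) \<Rightarrow> bool" where
  "admissible \<phi> x u \<longleftrightarrow>
     u \<in> borel_measurable (lebesgue_on {0<..<1}) \<and>
     (AE t in lebesgue_on {0<..<1}. -1 \<le> u t \<and> u t \<le> 3) \<and>
     continuous_on {-2..1} x \<and>
     (\<exists>L. L-lipschitz_on {0<..<1} x) \<and>
     (AE t in lebesgue_on {0<..<1}.
        (x has_real_derivative (1/10 * Sup ((\<lambda>s. u t * x s) ` {t-2..t}))) (at t)) \<and>
     (\<forall>t\<in>{-2..0}. x t = \<phi> t)"

text \<open>Cost functional.\<close>
definition cost :: "(real \<Rightarrow> real) \<Rightarrow> (real \<Rightarrow> real) \<Rightarrow> real" where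
  "cost x u = integral\<^sup>L (lebesgue_on {0<..<1}) (\<lambda>t. \<bar>x t - 2 * t\<bar>^2 + u t) + 4 * \<bar>x 1 - 2\<bar>"

end

theory Submission
  imports Defs
begin

text \<open>While the state stays in \<open>[-10, 10]\<close>, the maximum over the delay window \<open>[t - 2, t]\<close> is
  attained on the initial history, where \<open>\<phi>\<close> takes both values \<open>\<plusminus>10\<close>; so the dynamics reduce to
  \<open>x' = \<bar>u\<bar> \<le> 3\<close>, and a continuity argument shows that the state indeed never leaves
  \<open>[-10, 10]\<close>. Since \<open>\<bar>u\<bar> \<le> (u + 3)/2\<close> on \<open>[-1, 3]\<close>, integrating gives
  \<open>\<integral>u \<ge> 2 x(1) - 3\<close>, hence \<open>cost \<ge> \<integral>\<bar>x - 2t\<bar>\<^sup>2 + 2 x(1) - 3 + 4 \<bar>x(1) - 2\<bar> \<ge> 1\<close>; equality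
  would force \<open>x = 2t\<close>, hence \<open>u = 2\<close> and cost \<open>2\<close>. So every admissible cost exceeds \<open>1\<close>, while
  controls chattering between \<open>3\<close> and \<open>-1\<close> with period \<open>1/n\<close> track \<open>2t\<close> up to \<open>1/(2n)\<close> with
  \<open>\<integral>u = 1\<close>, at cost at most \<open>1 + 1/(4n\<^sup>2)\<close>.\<close>

lemma AE_lebesgue_on_iff_negligible:
  assumes "S \<in> sets lebesgue"
  shows "(AE t in lebesgue_on S. P t) \<longleftrightarrow> negligible {t \<in> S. \<not> P t}"
proof -
  have "(AE t in lebesgue_on S. P t) \<longleftrightarrow> (AE t in lebesgue. t \<in> S \<longrightarrow> P t)"
    using assms by (simp add: AE_restrict_space_iff)
  also have "\<dots> \<longleftrightarrow> (\<exists>N. negligible N \<and> {t. \<not> (t \<in> S \<longrightarrow> P t)} \<subseteq> N)"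
    by (rule eventually_ae_filter_negligible)
  also have "\<dots> \<longleftrightarrow> negligible {t \<in> S. \<not> P t}"
    by (metis (no_types, lifting) Collect_cong negligible_subset subset_refl)
  finally show ?thesis .
qed

lemma borel_measurable_lebesgue_onI:
  "f \<in> borel_measurable borel \<Longrightarrow> f \<in> borel_measurable (lebesgue_on S)"
  by (simp add: measurable_restrict_space1 measurable_completion measurable_lborel1)

lemma integral_le_negligible:
  fixes f g :: "'a::euclidean_space \<Rightarrow> real"
  assumes f: "f integrable_on S" and g: "g integrable_on S" and N: "negligible N"
    and le: "\<And>x. x \<in> S - N \<Longrightarrow> f x \<le> g x"
  shows "integral S f \<le> integral S g"
proof -
  define h where "h x = (if x \<in> N then g x else f x)" for x
  have "integral S f = integral S h"
    by (rule integral_spike[OF N]) (simp add: h_def)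
  also have "\<dots> \<le> integral S g"
  proof (rule Henstock_Kurzweil_Integration.integral_le)
    show "h integrable_on S"
      by (rule integrable_spike[OF f N]) (simp add: h_def)
  qed (simp_all add: g h_def le)
  finally show ?thesis .
qed

lemma bounded_measurable_integral_Ioo:
  fixes f :: "real \<Rightarrow> real"
  assumes meas: "f \<in> borel_measurable (lebesgue_on {a<..<b})"
    and bound: "AE t in lebesgue_on {a<..<b}. \<bar>f t\<bar> \<le> B"
  shows "f integrable_on {a..b}"
    and "integral\<^sup>L (lebesgue_on {a<..<b}) f = integral {a..b} f"
proof -
  interpret finite_measure "lebesgue_on {a<..<b}"
    by (rule finite_measure_lebesgue_on) simp
  have int: "integrable (lebesgue_on {a<..<b}) f"
    using bound by (intro integrable_const_bound[where B=B] meas) simp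
  have "{t \<in> {a<..<b} - {a..b}. f t \<noteq> 0} = {}"
    by auto
  then have "negligible {t \<in> {a<..<b} - {a..b}. f t \<noteq> 0}"
    by (metis negligible_empty)
  moreover have "negligible {t \<in> {a..b} - {a<..<b}. f t \<noteq> 0}"
    by (rule negligible_subset[of "{a, b}"]) (auto simp: negligible_finite)
  moreover have "(f has_integral integral\<^sup>L (lebesgue_on {a<..<b}) f) {a<..<b}"
    by (rule has_integral_integral_lebesgue_on[OF int]) simp
  ultimately have "(f has_integral integral\<^sup>L (lebesgue_on {a<..<b}) f) {a..b}"
    using has_integral_spike_set_eq by blast
  then show "f integrable_on {a..b}" and "integral\<^sup>L (lebesgue_on {a<..<b}) f = integral {a..b} f"
    by (auto simp: integral_unique)
qed

text \<open>The one-dimensional case of \<open>measure_differentiable_image\<close>, transferred along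
  \<open>vec :: real \<Rightarrow> real^1\<close>.\<close>

lemma measure_differentiable_image_real:
  fixes g g' :: "real \<Rightarrow> real"
  assumes S: "S \<in> sets lebesgue"
    and der: "\<And>x. x \<in> S \<Longrightarrow> (g has_real_derivative g' x) (at x within S)"
    and int: "(\<lambda>x. \<bar>g' x\<bar>) integrable_on S"
  shows "g ` S \<in> lmeasurable" and "measure lebesgue (g ` S) \<le> integral S (\<lambda>x. \<bar>g' x\<bar>)"
proof -
  let ?S = "vec ` S :: (real^1) set"
  let ?G = "\<lambda>v::real^1. vec (g (v $ 1)) :: real^1"
  let ?J = "\<lambda>v::real^1. \<bar>det (matrix ((*\<^sub>R) (g' (v $ 1))) :: real^1^1)\<bar>"
  have S': "?S \<in> sets lebesgue"
    by (auto intro: differentiable_image_in_sets_lebesgue [OF S] differentiable_vec)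
  have "(?G has_derivative (*\<^sub>R) (g' z)) (at (vec z) within ?S)" if "z \<in> S" for z
    using der [OF that]
    by (simp add: has_real_derivative_iff_has_vector_derivative has_vector_derivative_def
        has_derivative_vector_1)
  then have der': "\<And>v. v \<in> ?S \<Longrightarrow> (?G has_derivative (*\<^sub>R) (g' (v $ 1))) (at v within ?S)"
    by auto
  obtain I where I: "((\<lambda>x. \<bar>g' x\<bar>) has_integral I) S"
    using int by blast
  have "((?J \<circ> vec) has_integral I) ((\<lambda>v. v $ 1) ` ?S)"
    using I by (simp add: image_image o_def)
  then have J: "(?J has_integral I) ?S"
    by (rule has_integral_vec1_D)
  have M: "?G ` ?S \<in> lmeasurable" and M_le: "measure lebesgue (?G ` ?S) \<le> I"
    using measurable_differentiable_image[OF S' der'] measure_differentiable_image[OF S' der']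
      J integral_unique by blast+
  have "((\<lambda>v::real^1. 1::real) has_integral measure lebesgue (?G ` ?S)) (?G ` ?S)"
    using M lmeasure_integral lmeasurable_iff_integrable_on by (metis integrable_integral)
  then have "(((\<lambda>v::real^1. 1::real) \<circ> vec) has_integral measure lebesgue (?G ` ?S))
      ((\<lambda>v. v $ 1) ` ?G ` ?S)"
    by (rule has_integral_vec1_I)
  moreover have "(\<lambda>v. v $ 1) ` ?G ` ?S = g ` S"
    by (force simp: image_image)
  ultimately have gS: "((\<lambda>x. 1::real) has_integral measure lebesgue (?G ` ?S)) (g ` S)"
    by (simp add: o_def)
  then show gS_meas: "g ` S \<in> lmeasurable"
    using lmeasurable_iff_integrable_on by blast
  have "measure lebesgue (g ` S) = measure lebesgue (?G ` ?S)"
    using gS gS_meas lmeasure_integral integral_unique by metis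
  with M_le I show "measure lebesgue (g ` S) \<le> integral S (\<lambda>x. \<bar>g' x\<bar>)"
    using integral_unique by metis
qed

lemma negligible_lipschitz_on_image:
  fixes f :: "'a::euclidean_space \<Rightarrow> 'a"
  assumes lip: "K-lipschitz_on S f" and N: "negligible N" "N \<subseteq> S"
  shows "negligible (f ` N)"
proof (rule negligible_locally_Lipschitz_image)
  fix x assume "x \<in> N"
  then show "\<exists>T B. open T \<and> x \<in> T \<and> (\<forall>y\<in>N \<inter> T. norm (f y - f x) \<le> B * norm (y - x))"
    using N(2) lipschitz_onD[OF lip]
    by (intro exI[of _ UNIV] exI[of _ K]) (auto simp: dist_norm subset_eq)
qed (use N in auto)

text \<open>The Lipschitz hypothesis makes the image of the exceptional null set \<open>N\<close> null; without it,
  the Cantor function would be a counterexample.\<close>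

lemma abs_diff_le_integral_abs_deriv:
  fixes f f' :: "real \<Rightarrow> real"
  assumes ab: "a \<le> b" and cont: "continuous_on {a..b} f" and lip: "K-lipschitz_on {a<..<b} f"
    and N: "negligible N"
    and der: "\<And>t. t \<in> {a<..<b} - N \<Longrightarrow> (f has_real_derivative f' t) (at t)"
    and int: "(\<lambda>t. \<bar>f' t\<bar>) integrable_on {a..b}"
  shows "\<bar>f b - f a\<bar> \<le> integral {a..b} (\<lambda>t. \<bar>f' t\<bar>)"
proof -
  define G where "G = {a<..<b} - N"
  have G: "G \<in> sets lebesgue"
    unfolding G_def using N by (simp add: negligible_imp_sets sets.Diff)
  have spike: "negligible ({a..b} - G \<union> (G - {a..b}))"
    by (rule negligible_subset[of "N \<union> {a, b}"]) (auto simp: G_def N negligible_finite)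
  have intG: "(\<lambda>t. \<bar>f' t\<bar>) integrable_on G"
    using int integrable_spike_set_eq[OF spike] by blast
  have "(f has_real_derivative f' t) (at t within G)" if "t \<in> G" for t
    using der that by (auto simp: G_def intro: has_field_derivative_at_within)
  note image = measure_differentiable_image_real[OF G this intG]
  have "integral G (\<lambda>t. \<bar>f' t\<bar>) = integral {a..b} (\<lambda>t. \<bar>f' t\<bar>)"
    by (rule integral_spike_set) (auto intro: negligible_subset[OF spike])
  with image(2) have image_le: "measure lebesgue (f ` G) \<le> integral {a..b} (\<lambda>t. \<bar>f' t\<bar>)"
    by simp
  define Z where "Z = f ` ({a<..<b} \<inter> N) \<union> {f a, f b}"
  have "negligible (f ` ({a<..<b} \<inter> N))"
    using N by (intro negligible_lipschitz_on_image[OF lip]) (auto intro: negligible_subset)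
  then have Z: "negligible Z"
    unfolding Z_def by (simp add: negligible_finite)
  have "closed_segment (f a) (f b) \<subseteq> f ` {a..b}"
  proof
    fix y assume "y \<in> closed_segment (f a) (f b)"
    then obtain t where "t \<in> closed_segment a b" "f t = y"
      using IVT'_closed_segment_real cont ab by (metis closed_segment_eq_real_ivl1)
    then show "y \<in> f ` {a..b}"
      using ab by (auto simp: closed_segment_eq_real_ivl1)
  qed
  also have "\<dots> \<subseteq> f ` (G \<union> ({a<..<b} \<inter> N) \<union> {a, b})"
    by (intro image_mono) (auto simp: G_def)
  also have "\<dots> = f ` G \<union> Z"
    by (auto simp: Z_def)
  finally have segment: "closed_segment (f a) (f b) \<subseteq> f ` G \<union> Z" .
  have "\<bar>f b - f a\<bar> = measure lebesgue (closed_segment (f a) (f b))"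
    by (auto simp: closed_segment_eq_real_ivl lmeasure_integral)
  also have "\<dots> \<le> measure lebesgue (f ` G \<union> Z)"
    using segment image(1) Z negligible_imp_measurable
    by (intro measure_mono_fmeasurable) (auto simp: closed_segment_eq_real_ivl)
  also have "\<dots> \<le> measure lebesgue (f ` G) + measure lebesgue Z"
    using image(1) Z negligible_imp_measurable by (intro measure_Un_le) auto
  also have "\<dots> = measure lebesgue (f ` G)"
    using Z negligible_imp_measure0 by simp
  finally show ?thesis
    using image_le by linarith
qed

lemma continuous_on_less_bootstrap:
  fixes f :: "real \<Rightarrow> real"
  assumes cont: "continuous_on {a..b} f"
    and step: "\<And>s. s \<in> {a..b} \<Longrightarrow> (\<And>r. r \<in> {a..<s} \<Longrightarrow> f r \<le> M) \<Longrightarrow> f s < M"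
  shows "\<forall>s\<in>{a..b}. f s < M"
proof (rule ccontr)
  define C where "C = {s \<in> {a..b}. M \<le> f s}"
  assume "\<not> (\<forall>s\<in>{a..b}. f s < M)"
  then have nonempty: "C \<noteq> {}"
    unfolding C_def by (auto simp: not_less)
  have "closed C"
    unfolding C_def by (rule continuous_on_closed_Collect_le) (simp_all add: cont)
  moreover have "bounded C"
    unfolding C_def by (rule bounded_subset[of "{a..b}"]) auto
  ultimately have "compact C"
    by (simp add: compact_eq_bounded_closed)
  then obtain s where s: "s \<in> C" and first: "\<forall>r\<in>C. s \<le> r"
    using compact_attains_inf nonempty by blast
  have below: "f r \<le> M" if r: "r \<in> {a..<s}" for r
  proof -
    have "r \<in> {a..b}"
      using r s unfolding C_def by auto
    moreover have "r \<notin> C"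
      using r first by auto
    ultimately show ?thesis
      unfolding C_def by auto
  qed
  have "f s < M"
    by (rule step) (use s below in \<open>auto simp: C_def\<close>)
  with s show False
    unfolding C_def by simp
qed

lemma finite_sin_zeros:
  fixes c :: real
  assumes "0 < c"
  shows "finite {t \<in> {a..b}. sin (c * t) = 0}"
proof -
  have "{t \<in> {a..b}. sin (c * t) = 0} \<subseteq>
      (\<lambda>i. real_of_int i * pi / c) ` {\<lfloor>c * a / pi\<rfloor>..\<lceil>c * b / pi\<rceil>}"
  proof
    fix t assume t: "t \<in> {t \<in> {a..b}. sin (c * t) = 0}"
    then obtain i where i: "c * t = real_of_int i * pi"
      using sin_zero_iff_int2 by auto
    have "c * a \<le> c * t" "c * t \<le> c * b"
      using t assms by (simp_all add: mult_left_mono)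
    then have "c * a / pi \<le> real_of_int i" "real_of_int i \<le> c * b / pi"
      using i by (simp_all add: pos_divide_le_eq pos_le_divide_eq)
    then have "i \<in> {\<lfloor>c * a / pi\<rfloor>..\<lceil>c * b / pi\<rceil>}"
      by (auto simp: floor_le_iff le_ceiling_iff)
    moreover have "t = real_of_int i * pi / c"
      using i assms by (auto simp: field_simps)
    ultimately show "t \<in> (\<lambda>i. real_of_int i * pi / c) ` {\<lfloor>c * a / pi\<rfloor>..\<lceil>c * b / pi\<rceil>}"
      by blast
  qed
  then show ?thesis
    by (rule finite_subset) simp
qed

text \<open>\<open>zigzag n t\<close> is the distance from \<open>t\<close> to the grid \<open>\<int>/n\<close>: a sawtooth of slopes \<open>\<plusminus>1\<close>
  and height \<open>1/(2n)\<close>.\<close>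

definition zigzag :: "nat \<Rightarrow> real \<Rightarrow> real" where
  "zigzag n t = arccos (cos (2 * pi * n * t)) / (2 * pi * n)"

lemma continuous_on_zigzag: "continuous_on A (zigzag n)"
proof -
  have "continuous_on A (\<lambda>t. arccos (cos (2 * pi * n * t)))"
    by (intro continuous_on_arccos continuous_intros) simp
  then have "continuous_on A (\<lambda>t. arccos (cos (2 * pi * n * t)) * inverse (2 * pi * n))"
    by (rule continuous_on_mult_right)
  then show ?thesis
    unfolding zigzag_def[abs_def] divide_inverse .
qed

lemma zigzag_0 [simp]: "zigzag n 0 = 0"
  by (simp add: zigzag_def)

lemma zigzag_1 [simp]: "zigzag n 1 = 0"
  using cos_int_2pin[of "int n"] by (simp add: zigzag_def)

lemma zigzag_nonneg: "0 \<le> zigzag n t"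
  unfolding zigzag_def by (intro divide_nonneg_nonneg arccos_lbound) auto

lemma zigzag_le:
  assumes "0 < n"
  shows "zigzag n t \<le> 1 / (2 * real n)"
proof -
  have "zigzag n t \<le> pi / (2 * pi * n)"
    unfolding zigzag_def using assms by (intro divide_right_mono arccos_ubound) auto
  then show ?thesis
    by simp
qed

lemma zigzag_le_half:
  assumes "0 < n"
  shows "zigzag n t \<le> 1 / 2"
proof -
  have "1 \<le> real n"
    using assms by simp
  then have "1 / (2 * real n) \<le> 1 / 2"
    by (simp add: field_simps)
  with zigzag_le[OF assms] show ?thesis
    by (rule order_trans)
qed

lemma has_real_derivative_zigzag:
  assumes n: "0 < n" and nonzero: "sin (2 * pi * n * t) \<noteq> 0"
  shows "(zigzag n has_real_derivative sgn (sin (2 * pi * n * t))) (at t)"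
proof -
  define c where "c = 2 * pi * n"
  have c: "0 < c"
    using n by (simp add: c_def)
  have sin_cos: "(sin (c * t))\<^sup>2 + (cos (c * t))\<^sup>2 = 1"
    by simp
  have "(cos (c * t))\<^sup>2 < 1"
    using nonzero sin_cos unfolding c_def by (smt (verit) zero_less_power2)
  then have "\<bar>cos (c * t)\<bar> < 1"
    by (simp add: abs_square_less_1)
  then have "((\<lambda>t. arccos (cos (c * t))) has_real_derivative
      inverse (- sqrt (1 - (cos (c * t))\<^sup>2)) * (- sin (c * t) * c)) (at t)"
    by (intro DERIV_chain2[OF DERIV_arccos]) (auto intro!: derivative_eq_intros)
  then have "((\<lambda>t. arccos (cos (c * t)) / c) has_real_derivative
      inverse (- sqrt (1 - (cos (c * t))\<^sup>2)) * (- sin (c * t) * c) / c) (at t)"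
    by (rule DERIV_cdivide)
  moreover have "sqrt (1 - (cos (c * t))\<^sup>2) = \<bar>sin (c * t)\<bar>"
    using sin_cos by (metis add_diff_cancel_right' real_sqrt_abs)
  then have "inverse (- sqrt (1 - (cos (c * t))\<^sup>2)) * (- sin (c * t) * c) / c = sgn (sin (c * t))"
    using c nonzero by (simp add: field_simps sgn_if)
  moreover have "zigzag n = (\<lambda>t. arccos (cos (c * t)) / c)"
    by (simp add: fun_eq_iff zigzag_def c_def)
  ultimately show ?thesis
    by (simp add: c_def)
qed

lemma zigzag_has_integral:
  assumes "0 < n" and "p \<le> q"
  shows "((\<lambda>t. sgn (sin (2 * pi * n * t))) has_integral zigzag n q - zigzag n p) {p..q}"
proof (rule fundamental_theorem_of_calculus_strong)
  show "finite {t \<in> {p..q}. sin (2 * pi * n * t) = 0}"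
    using assms by (intro finite_sin_zeros) auto
  fix t assume "t \<in> {p..q} - {t \<in> {p..q}. sin (2 * pi * n * t) = 0}"
  then show "(zigzag n has_vector_derivative sgn (sin (2 * pi * n * t))) (at t)"
    using has_real_derivative_zigzag[OF \<open>0 < n\<close>]
    by (auto simp: has_real_derivative_iff_has_vector_derivative[symmetric])
qed (use assms continuous_on_zigzag in auto)

lemma abs_zigzag_diff_le:
  assumes "0 < n"
  shows "\<bar>zigzag n s - zigzag n t\<bar> \<le> \<bar>s - t\<bar>"
proof -
  have ordered: "\<bar>zigzag n q - zigzag n p\<bar> \<le> q - p" if "p \<le> q" for p q
    using has_integral_bound_real[where B=1 and S="{}", OF _ _ zigzag_has_integral[OF assms that]]
    by (simp add: sgn_if that)
  show ?thesis
  proof (cases "t \<le> s")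
    case True
    then show ?thesis
      using ordered[of t s] by simp
  next
    case False
    then show ?thesis
      using ordered[of s t] by (simp add: abs_minus_commute)
  qed
qed

lemma integral_zigzag_sq_le:
  assumes n: "0 < n"
  shows "integral {0..1} (\<lambda>t. (zigzag n t)\<^sup>2) \<le> 1 / (4 * (real n)\<^sup>2)"
proof -
  have "(zigzag n t)\<^sup>2 \<le> 1 / (4 * (real n)\<^sup>2)" for t
  proof -
    have "(zigzag n t)\<^sup>2 \<le> (1 / (2 * real n))\<^sup>2"
      using zigzag_nonneg zigzag_le[OF n] by (intro power_mono)
    then show ?thesis
      by (simp add: power2_eq_square)
  qed
  then have "integral {0..1} (\<lambda>t. (zigzag n t)\<^sup>2) \<le> integral {0..1} (\<lambda>_::real. 1 / (4 * (real n)\<^sup>2))"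
    by (intro Henstock_Kurzweil_Integration.integral_le integrable_continuous_real continuous_intros
        continuous_on_zigzag integrable_const_ivl)
  then show ?thesis
    by simp
qed

definition chattering_control :: "nat \<Rightarrow> real \<Rightarrow> real" where
  "chattering_control n t = 1 + 2 * sgn (sin (2 * pi * n * t))"

lemma chattering_control_bounds: "-1 \<le> chattering_control n t" "chattering_control n t \<le> 3"
  by (simp_all add: chattering_control_def sgn_if)

lemma chattering_control_has_integral:
  assumes "0 < n"
  shows "(chattering_control n has_integral 1) {0..1}"
proof -
  have "((\<lambda>t. 1 + 2 * sgn (sin (2 * pi * n * t))) has_integral 1 + 2 * 0) {0..1}"
    using zigzag_has_integral[OF assms, of 0 1] has_integral_const_real[of "1::real" 0 1]
    by (intro has_integral_add has_integral_mult_right) auto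
  then show ?thesis
    by (simp add: chattering_control_def[abs_def])
qed

lemma borel_measurable_chattering_control:
  "chattering_control n \<in> borel_measurable (lebesgue_on S)"
  unfolding chattering_control_def[abs_def] by (rule borel_measurable_lebesgue_onI) measurable

locale delay_problem =
  fixes \<phi> :: "real \<Rightarrow> real"
  assumes range_left: "\<phi> ` {-2..-1} = {-10..10}"
    and range_right: "\<phi> ` {-1..0} = {-10..10}"
    and initial_zero: "\<phi> 0 = 0"
begin

lemma Sup_delay_window:
  assumes history: "\<And>s. s \<in> {-2..0} \<Longrightarrow> z s = \<phi> s"
    and small: "\<And>s. s \<in> {0..t} \<Longrightarrow> \<bar>z s\<bar> \<le> 10"
    and t: "0 \<le> t" "t \<le> 1"
  shows "Sup ((\<lambda>s. c * z s) ` {t-2..t}) = 10 * \<bar>c\<bar>"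
proof (rule cSup_eq_maximum)
  have bound: "\<bar>z s\<bar> \<le> 10" if "s \<in> {t-2..t}" for s
  proof (cases "s \<le> 0")
    case True
    then have "s \<in> {-2..-1} \<or> s \<in> {-1..0}"
      using that t by auto
    then have "\<phi> s \<in> {-10..10}"
      using range_left range_right by blast
    then show ?thesis
      using history[of s] True that t by auto
  next
    case False
    then show ?thesis
      using small[of s] that by auto
  qed
  show "y \<le> 10 * \<bar>c\<bar>" if y: "y \<in> (\<lambda>s. c * z s) ` {t-2..t}" for y
  proof -
    obtain s where s: "s \<in> {t-2..t}" "y = c * z s"
      using y by blast
    have "c * z s \<le> \<bar>c\<bar> * \<bar>z s\<bar>"
      by (metis abs_ge_self abs_mult)
    also have "\<dots> \<le> \<bar>c\<bar> * 10"
      using bound[OF s(1)] by (simp add: mult_left_mono)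
    finally show ?thesis
      using s by simp
  qed
  have "10 \<in> \<phi> ` {-1..0}" and "-10 \<in> \<phi> ` {-1..0}"
    using range_right by auto
  then obtain p q where p: "p \<in> {-1..0}" "\<phi> p = 10" and q: "q \<in> {-1..0}" "\<phi> q = -10"
    by (metis imageE)
  define w where "w = (if 0 \<le> c then p else q)"
  have "c * z w = 10 * \<bar>c\<bar>" and "w \<in> {t-2..t}"
    using p q history[of p] history[of q] t by (auto simp: w_def)
  then show "10 * \<bar>c\<bar> \<in> (\<lambda>s. c * z s) ` {t-2..t}"
    by force
qed

definition chattering_state :: "nat \<Rightarrow> real \<Rightarrow> real" where
  "chattering_state n t = (if t \<le> 0 then \<phi> t else 2 * t + zigzag n t)"

lemma chattering_state_nonneg:
  "0 \<le> t \<Longrightarrow> chattering_state n t = 2 * t + zigzag n t"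
  by (simp add: chattering_state_def initial_zero)

lemma abs_chattering_state_le:
  assumes "0 < n" and "s \<in> {0..1}"
  shows "\<bar>chattering_state n s\<bar> \<le> 3"
  using assms zigzag_nonneg[of n s] zigzag_le_half[of n s] by (simp add: chattering_state_nonneg)

lemma continuous_on_chattering_state:
  assumes "continuous_on {-2..0} \<phi>"
  shows "continuous_on {-2..1} (chattering_state n)"
proof -
  have "continuous_on {-2..0} (chattering_state n)"
    using assms by (rule continuous_on_eq) (simp add: chattering_state_def)
  moreover have "continuous_on {0..1} (\<lambda>t. 2 * t + zigzag n t)"
    by (intro continuous_intros continuous_on_zigzag)
  then have "continuous_on {0..1} (chattering_state n)"
    by (rule continuous_on_eq) (simp add: chattering_state_nonneg)
  ultimately have "continuous_on ({-2..0} \<union> {0..1}) (chattering_state n)"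
    by (intro continuous_on_closed_Un) auto
  moreover have "{-2..0} \<union> {0..1} = {-2..1::real}"
    by auto
  ultimately show ?thesis
    by simp
qed

lemma lipschitz_on_chattering_state:
  assumes n: "0 < n"
  shows "3-lipschitz_on {0<..<1} (chattering_state n)"
proof (rule lipschitz_onI)
  fix s t :: real assume "s \<in> {0<..<1}" "t \<in> {0<..<1}"
  then have "chattering_state n s - chattering_state n t = 2 * (s - t) + (zigzag n s - zigzag n t)"
    by (simp add: chattering_state_nonneg)
  then have "\<bar>chattering_state n s - chattering_state n t\<bar>
      \<le> \<bar>2 * (s - t)\<bar> + \<bar>zigzag n s - zigzag n t\<bar>"
    by (simp only: abs_triangle_ineq)
  also have "\<dots> \<le> 2 * \<bar>s - t\<bar> + \<bar>s - t\<bar>"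
    using abs_zigzag_diff_le[OF n, of s t] by (simp only: abs_mult abs_numeral add_left_mono)
  finally show "dist (chattering_state n s) (chattering_state n t) \<le> 3 * dist s t"
    by (simp add: dist_real_def)
qed simp

lemma chattering_state_dynamics:
  assumes n: "0 < n" and t: "t \<in> {0<..<1}" and nonzero: "sin (2 * pi * n * t) \<noteq> 0"
  shows "(chattering_state n has_real_derivative
      1/10 * Sup ((\<lambda>s. chattering_control n t * chattering_state n s) ` {t-2..t})) (at t)"
proof -
  have "((\<lambda>t. 2 * t + zigzag n t) has_real_derivative 2 + sgn (sin (2 * pi * n * t))) (at t)"
    using has_real_derivative_zigzag[OF n nonzero] by (auto intro!: derivative_eq_intros)
  then have "(chattering_state n has_real_derivative 2 + sgn (sin (2 * pi * n * t))) (at t)"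
    by (rule has_field_derivative_transform_within_open[where S="{0<..}"])
      (use t in \<open>auto simp: chattering_state_nonneg\<close>)
  moreover have "2 + sgn (sin (2 * pi * n * t)) = \<bar>chattering_control n t\<bar>"
    using nonzero by (simp add: chattering_control_def sgn_if)
  moreover have "Sup ((\<lambda>s. chattering_control n t * chattering_state n s) ` {t-2..t})
      = 10 * \<bar>chattering_control n t\<bar>"
  proof (rule Sup_delay_window)
    show "chattering_state n s = \<phi> s" if "s \<in> {-2..0}" for s
      using that by (simp add: chattering_state_def)
    show "\<bar>chattering_state n s\<bar> \<le> 10" if "s \<in> {0..t}" for s
      using that t abs_chattering_state_le[OF n, of s] by simp
  qed (use t in auto)
  ultimately show ?thesis
    by simp
qed

lemma admissible_chattering:
  assumes n: "0 < n" and history: "continuous_on {-2..0} \<phi>"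
  shows "admissible \<phi> (chattering_state n) (chattering_control n)"
  unfolding admissible_def
proof (intro conjI)
  let ?y = "chattering_state n" and ?v = "chattering_control n"
  show "?v \<in> borel_measurable (lebesgue_on {0<..<1})"
    by (rule borel_measurable_chattering_control)
  show "AE t in lebesgue_on {0<..<1}. -1 \<le> ?v t \<and> ?v t \<le> 3"
    by (simp add: chattering_control_bounds)
  show "continuous_on {-2..1} ?y"
    using history by (rule continuous_on_chattering_state)
  show "\<exists>L. L-lipschitz_on {0<..<1} ?y"
    using lipschitz_on_chattering_state[OF n] by blast
  let ?P = "\<lambda>t. (?y has_real_derivative 1/10 * Sup ((\<lambda>s. ?v t * ?y s) ` {t-2..t})) (at t)"
  have "{t \<in> {0<..<1}. \<not> ?P t} \<subseteq> {t \<in> {0..1}. sin (2 * pi * n * t) = 0}"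
    using chattering_state_dynamics[OF n] by auto
  moreover have "finite {t \<in> {0..1}. sin (2 * pi * n * t) = 0}"
    using n by (intro finite_sin_zeros) simp
  ultimately have "negligible {t \<in> {0<..<1}. \<not> ?P t}"
    using negligible_finite negligible_subset by blast
  then show "AE t in lebesgue_on {0<..<1}. ?P t"
    by (simp add: AE_lebesgue_on_iff_negligible)
  show "\<forall>t\<in>{-2..0}. ?y t = \<phi> t"
    by (simp add: chattering_state_def)
qed

lemma cost_chattering_le:
  assumes n: "0 < n"
  shows "cost (chattering_state n) (chattering_control n) \<le> 1 + 1 / (4 * (real n)\<^sup>2)"
proof -
  let ?v = "chattering_control n"
  define g where "g t = (zigzag n t)\<^sup>2 + ?v t" for t
  have bound: "\<bar>g t\<bar> \<le> 4" for t
  proof -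
    have "(zigzag n t)\<^sup>2 \<le> 1"
      using zigzag_nonneg[of n t] zigzag_le_half[OF n, of t] by (intro power_le_one) auto
    moreover have "0 \<le> (zigzag n t)\<^sup>2"
      by simp
    ultimately show ?thesis
      using chattering_control_bounds[of n t] unfolding g_def abs_le_iff by linarith
  qed
  have [measurable]: "zigzag n \<in> borel_measurable (lebesgue_on {0<..<1})"
    by (rule continuous_imp_measurable_on_sets_lebesgue[OF continuous_on_zigzag]) simp
  note [measurable] = borel_measurable_chattering_control
  have "g \<in> borel_measurable (lebesgue_on {0<..<1})"
    unfolding g_def by measurable
  note g_integral = bounded_measurable_integral_Ioo[OF this AE_I2[OF bound]]
  have "integral\<^sup>L (lebesgue_on {0<..<1}) (\<lambda>t. \<bar>chattering_state n t - 2 * t\<bar>\<^sup>2 + ?v t)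
      = integral\<^sup>L (lebesgue_on {0<..<1}) g"
    by (rule Bochner_Integration.integral_cong) (auto simp: g_def chattering_state_nonneg)
  also have "\<dots> = integral {0..1} (\<lambda>t. (zigzag n t)\<^sup>2) + integral {0..1} ?v"
    unfolding g_integral(2) g_def
  proof (rule integral_add)
    show "(\<lambda>t. (zigzag n t)\<^sup>2) integrable_on {0..1}"
      by (intro integrable_continuous_real continuous_intros continuous_on_zigzag)
  qed (use chattering_control_has_integral[OF n] in blast)
  also have "\<dots> \<le> 1 / (4 * (real n)\<^sup>2) + 1"
    using integral_zigzag_sq_le[OF n] integral_unique[OF chattering_control_has_integral[OF n]]
    by simp
  finally show ?thesis
    by (simp add: cost_def chattering_state_nonneg)
qed

end

locale admissible_pair = delay_problem +
  fixes x u :: "real \<Rightarrow> real"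
  assumes admissible: "admissible \<phi> x u"
begin

lemma control_measurable: "u \<in> borel_measurable (lebesgue_on {0<..<1})"
  and control_bounds: "AE t in lebesgue_on {0<..<1}. -1 \<le> u t \<and> u t \<le> 3"
  and state_continuous: "continuous_on {-2..1} x"
  and state_lipschitz: "\<exists>L. L-lipschitz_on {0<..<1} x"
  and state_history: "\<And>t. t \<in> {-2..0} \<Longrightarrow> x t = \<phi> t"
  using admissible unfolding admissible_def by auto

lemma state_0: "x 0 = 0"
  using state_history[of 0] initial_zero by simp

lemma continuous_on_history: "continuous_on {-2..0} \<phi>"
  using continuous_on_subset[OF state_continuous, of "{-2..0}"] state_history
  by (auto intro: continuous_on_eq)

definition good :: "real \<Rightarrow> bool" where
  "good t \<longleftrightarrow> -1 \<le> u t \<and> u t \<le> 3 \<and>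
     (x has_real_derivative 1/10 * Sup ((\<lambda>s. u t * x s) ` {t-2..t})) (at t)"

lemma negligible_not_good: "negligible {t \<in> {0..1}. \<not> good t}"
proof -
  have "AE t in lebesgue_on {0<..<1}. good t"
    using admissible unfolding admissible_def good_def by (auto elim: AE_mp)
  then have "negligible {t \<in> {0<..<1}. \<not> good t}"
    by (simp add: AE_lebesgue_on_iff_negligible)
  then have "negligible ({t \<in> {0<..<1}. \<not> good t} \<union> {0, 1})"
    by (simp add: negligible_finite)
  then show ?thesis
    by (rule negligible_subset) auto
qed

lemma control_integrable: "u integrable_on {0..1}" "(\<lambda>t. \<bar>u t\<bar>) integrable_on {0..1}"
proof -
  have bound: "AE t in lebesgue_on {0<..<1}. \<bar>u t\<bar> \<le> 3"
    using control_bounds by eventually_elim auto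
  then show "u integrable_on {0..1}"
    by (rule bounded_measurable_integral_Ioo(1)[OF control_measurable])
  have "(\<lambda>t. \<bar>u t\<bar>) \<in> borel_measurable (lebesgue_on {0<..<1})"
    using control_measurable by measurable
  moreover have "AE t in lebesgue_on {0<..<1}. \<bar>\<bar>u t\<bar>\<bar> \<le> 3"
    using bound by simp
  ultimately show "(\<lambda>t. \<bar>u t\<bar>) integrable_on {0..1}"
    by (rule bounded_measurable_integral_Ioo(1))
qed

lemma integral_abs_control_le:
  assumes "s \<in> {0..1}"
  shows "integral {0..s} (\<lambda>t. \<bar>u t\<bar>) \<le> 3 * s"
proof -
  have "integral {0..s} (\<lambda>t. \<bar>u t\<bar>) \<le> integral {0..s} (\<lambda>_. 3)"
  proof (rule integral_le_negligible[OF _ _ negligible_not_good])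
    show "(\<lambda>t. \<bar>u t\<bar>) integrable_on {0..s}"
      by (rule integrable_on_subinterval[OF control_integrable(2)]) (use assms in auto)
    show "\<bar>u t\<bar> \<le> 3" if "t \<in> {0..s} - {t \<in> {0..1}. \<not> good t}" for t
      using that assms by (auto simp: good_def)
  qed (simp add: integrable_const_ivl)
  then show ?thesis
    using assms by simp
qed

lemma has_real_derivative_abs_control:
  assumes t: "t \<in> {0..1}" "good t" and small: "\<And>s. s \<in> {0..t} \<Longrightarrow> \<bar>x s\<bar> \<le> 10"
  shows "(x has_real_derivative \<bar>u t\<bar>) (at t)"
proof -
  have "Sup ((\<lambda>s. u t * x s) ` {t-2..t}) = 10 * \<bar>u t\<bar>"
    using t by (intro Sup_delay_window state_history small) auto
  then show ?thesis
    using t(2) by (simp add: good_def)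
qed

lemma abs_state_le_integral:
  assumes s: "s \<in> {0..1}" and small: "\<And>r. r \<in> {0..<s} \<Longrightarrow> \<bar>x r\<bar> \<le> 10"
  shows "\<bar>x s\<bar> \<le> integral {0..s} (\<lambda>t. \<bar>u t\<bar>)"
proof -
  obtain L where L: "L-lipschitz_on {0<..<1} x"
    using state_lipschitz by blast
  have "\<bar>x s - x 0\<bar> \<le> integral {0..s} (\<lambda>t. \<bar>\<bar>u t\<bar>\<bar>)"
  proof (rule abs_diff_le_integral_abs_deriv[OF _ _ _ negligible_not_good])
    show "continuous_on {0..s} x"
      using s by (intro continuous_on_subset[OF state_continuous]) auto
    show "L-lipschitz_on {0<..<s} x"
      using s by (intro lipschitz_on_subset[OF L]) auto
    show "(\<lambda>t. \<bar>\<bar>u t\<bar>\<bar>) integrable_on {0..s}"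
      by (simp, rule integrable_on_subinterval[OF control_integrable(2)]) (use s in auto)
    show "(x has_real_derivative \<bar>u t\<bar>) (at t)" if "t \<in> {0<..<s} - {t \<in> {0..1}. \<not> good t}" for t
      using that s by (intro has_real_derivative_abs_control small) auto
  qed (use s in auto)
  then show ?thesis
    by (simp add: state_0)
qed

lemma abs_state_less: "r \<in> {0..1} \<Longrightarrow> \<bar>x r\<bar> < 10"
proof -
  have "\<forall>s\<in>{0..1}. \<bar>x s\<bar> < 10"
  proof (rule continuous_on_less_bootstrap)
    show "continuous_on {0..1} (\<lambda>s. \<bar>x s\<bar>)"
      by (intro continuous_intros continuous_on_subset[OF state_continuous]) auto
    fix s :: real assume s: "s \<in> {0..1}" and "\<And>r. r \<in> {0..<s} \<Longrightarrow> \<bar>x r\<bar> \<le> 10"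
    then have "\<bar>x s\<bar> \<le> 3 * s"
      using abs_state_le_integral integral_abs_control_le order_trans by blast
    then show "\<bar>x s\<bar> < 10"
      using s by simp
  qed
  then show "r \<in> {0..1} \<Longrightarrow> \<bar>x r\<bar> < 10"
    by blast
qed

lemma has_real_derivative_state:
  "t \<in> {0..1} \<Longrightarrow> good t \<Longrightarrow> (x has_real_derivative \<bar>u t\<bar>) (at t)"
  using abs_state_less by (intro has_real_derivative_abs_control) (auto intro: less_imp_le)

lemma state_1_le: "x 1 \<le> integral {0..1} (\<lambda>t. \<bar>u t\<bar>)"
proof -
  have "\<bar>x 1\<bar> \<le> integral {0..1} (\<lambda>t. \<bar>u t\<bar>)"
    using abs_state_less by (intro abs_state_le_integral less_imp_le) auto
  then show ?thesis
    by simp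
qed

lemma cost_eq:
  "cost x u = integral {0..1} (\<lambda>t. (x t - 2 * t)\<^sup>2) + integral {0..1} u + 4 * \<bar>x 1 - 2\<bar>"
proof -
  have [measurable]: "x \<in> borel_measurable (lebesgue_on {0<..<1})"
    by (rule continuous_imp_measurable_on_sets_lebesgue[OF continuous_on_subset[OF state_continuous]])
      auto
  have [measurable]: "(\<lambda>t::real. t) \<in> borel_measurable (lebesgue_on {0<..<1})"
    by (rule borel_measurable_lebesgue_onI) simp
  note [measurable] = control_measurable
  have "AE t in lebesgue_on {0<..<1}. \<bar>\<bar>x t - 2 * t\<bar>\<^sup>2 + u t\<bar> \<le> 147"
    using control_bounds AE_space[of "lebesgue_on {0<..<1}"]
  proof eventually_elim
    case (elim t)
    then have "\<bar>x t - 2 * t\<bar> \<le> 12"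
      using abs_state_less[of t] by auto
    then have "\<bar>x t - 2 * t\<bar>\<^sup>2 \<le> 144"
      using power_mono[of "\<bar>x t - 2 * t\<bar>" 12 2] by simp
    moreover have "0 \<le> \<bar>x t - 2 * t\<bar>\<^sup>2"
      by (rule zero_le_power2)
    ultimately show ?case
      using elim unfolding abs_le_iff[of "\<bar>x t - 2 * t\<bar>\<^sup>2 + u t"] by linarith
  qed
  then have "integral\<^sup>L (lebesgue_on {0<..<1}) (\<lambda>t. \<bar>x t - 2 * t\<bar>\<^sup>2 + u t)
      = integral {0..1} (\<lambda>t. (x t - 2 * t)\<^sup>2 + u t)"
    by (subst bounded_measurable_integral_Ioo(2)) auto
  also have "\<dots> = integral {0..1} (\<lambda>t. (x t - 2 * t)\<^sup>2) + integral {0..1} u"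
  proof (rule integral_add[OF _ control_integrable(1)])
    show "(\<lambda>t. (x t - 2 * t)\<^sup>2) integrable_on {0..1}"
      by (intro integrable_continuous_real continuous_intros continuous_on_subset[OF state_continuous])
        auto
  qed
  finally show ?thesis
    by (simp add: cost_def)
qed

lemma integral_sq_error_add_one_le_cost: "integral {0..1} (\<lambda>t. (x t - 2 * t)\<^sup>2) + 1 \<le> cost x u"
proof -
  have average: "((\<lambda>t. (u t + 3) / 2) has_integral (integral {0..1} u + 3) / 2) {0..1}"
    using has_integral_const_real[of "3::real" 0 1] integrable_integral[OF control_integrable(1)]
    by (intro has_integral_divide has_integral_add) auto
  have "integral {0..1} (\<lambda>t. \<bar>u t\<bar>) \<le> integral {0..1} (\<lambda>t. (u t + 3) / 2)"
  proof (rule integral_le_negligible[OF control_integrable(2) _ negligible_not_good])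
    show "(\<lambda>t. (u t + 3) / 2) integrable_on {0..1}"
      using average by blast
    show "\<bar>u t\<bar> \<le> (u t + 3) / 2" if "t \<in> {0..1} - {t \<in> {0..1}. \<not> good t}" for t
      using that by (auto simp: good_def)
  qed
  also have "\<dots> = (integral {0..1} u + 3) / 2"
    using average by (rule integral_unique)
  finally have "2 * x 1 - 3 \<le> integral {0..1} u"
    using state_1_le by simp
  then show ?thesis
    unfolding cost_eq by (simp add: abs_if)
qed

lemma cost_eq_2_if_tracking_exact:
  assumes exact: "integral {0..1} (\<lambda>t. (x t - 2 * t)\<^sup>2) = 0"
  shows "cost x u = 2"
proof -
  have sq_continuous: "continuous_on {0..1} (\<lambda>t. (x t - 2 * t)\<^sup>2)"
    by (intro continuous_intros continuous_on_subset[OF state_continuous]) auto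
  have straight: "x t = 2 * t" if "t \<in> {0..1}" for t
  proof -
    have "((\<lambda>t. (x t - 2 * t)\<^sup>2) has_integral 0) (cbox 0 1)"
      using exact integrable_integral[OF integrable_continuous_real[OF sq_continuous]] by simp
    then have "(x t - 2 * t)\<^sup>2 = 0"
      using sq_continuous that by (intro has_integral_0_cbox_imp_0) auto
    then show ?thesis
      by simp
  qed
  have control_2: "u t = 2" if t: "t \<in> {0<..<1}" "good t" for t
  proof -
    have "(x has_real_derivative 2) (at t)"
    proof (rule has_field_derivative_transform_within_open[where f="\<lambda>t. 2 * t" and S="{0<..<1}"])
      show "((\<lambda>t. 2 * t) has_real_derivative 2) (at t)"
        by (auto intro!: derivative_eq_intros)
    qed (use t straight in auto)
    moreover have "(x has_real_derivative \<bar>u t\<bar>) (at t)"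
      using t by (intro has_real_derivative_state) auto
    ultimately have "\<bar>u t\<bar> = 2"
      by (rule DERIV_unique[rotated])
    then show ?thesis
      using t(2) by (auto simp: good_def)
  qed
  have "integral {0..1} u = integral {0..1} (\<lambda>_::real. 2::real)"
  proof (rule integral_spike)
    show "negligible ({t \<in> {0..1}. \<not> good t} \<union> {0, 1})"
      by (rule negligible_Un[OF negligible_not_good]) (simp add: negligible_finite)
    show "2 = u t" if "t \<in> {0..1} - ({t \<in> {0..1}. \<not> good t} \<union> {0, 1})" for t
      using that control_2[of t] by auto
  qed
  then show ?thesis
    using exact straight[of 1] unfolding cost_eq by simp
qed

lemma cost_gt_one: "1 < cost x u"
proof -
  have "0 \<le> integral {0..1} (\<lambda>t. (x t - 2 * t)\<^sup>2)"
    by (intro integral_nonneg integrable_continuous_real continuous_intros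
        continuous_on_subset[OF state_continuous]) auto
  then show ?thesis
    using integral_sq_error_add_one_le_cost cost_eq_2_if_tracking_exact by fastforce
qed

end

theorem theorem3p5:
  fixes \<phi> :: "real \<Rightarrow> real"
  assumes "\<phi> ` {-2..-1} = {-10..10}"
      and "\<phi> ` {-1..0} = {-10..10}"
      and "\<phi> 0 = 0"
  shows "\<not> (\<exists>x u. admissible \<phi> x u \<and> (\<forall>y v. admissible \<phi> y v \<longrightarrow> cost x u \<le> cost y v))"
proof
  assume "\<exists>x u. admissible \<phi> x u \<and> (\<forall>y v. admissible \<phi> y v \<longrightarrow> cost x u \<le> cost y v)"
  then obtain x u where "admissible \<phi> x u"
    and optimal: "\<And>y v. admissible \<phi> y v \<Longrightarrow> cost x u \<le> cost y v"
    by blast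
  then interpret admissible_pair \<phi> x u
    using assms by unfold_locales
  obtain n :: nat where n: "0 < n" "inverse (real n) < cost x u - 1"
    using ex_inverse_of_nat_less[of "cost x u - 1"] cost_gt_one by auto
  have "real n \<le> 4 * (real n)\<^sup>2"
    using n(1) by (simp add: power2_eq_square mult_le_cancel_left1)
  then have "1 / (4 * (real n)\<^sup>2) \<le> inverse (real n)"
    using n(1) by (simp add: field_simps)
  then have "cost (chattering_state n) (chattering_control n) < cost x u"
    using cost_chattering_le[OF n(1)] n(2) by linarith
  moreover have "cost x u \<le> cost (chattering_state n) (chattering_control n)"
    by (rule optimal[OF admissible_chattering[OF n(1) continuous_on_history]])
  ultimately show False
    by simp
qed

end
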